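(* Let $(L,\vee,\wedge,0,1)$ be a non-trivial complete lattice, let $(T,R)$ be a time frame, let $P,F,H,G\colon L^T\to L^T$ denote the tense operators induced by $(T,R)$, and let $R^*$ denote the relation induced by $P$, $F$, $H$ and $G$. Then $R=R^*$, and hence the tense operators induced by the time frame $(T,R^* )$ coincide with those induced by the time frame $(T,R)$.
   Context: A time frame is a pair $(T,R)$ consisting of a non-empty set $T$ and a non-empty binary relation $R\subseteq T\times T$; $s\mathrel R t$ means $(s,t)\in R$. Here $0$ and $1$ are the least and greatest elements of $L$; non-trivial means that $L$ has more than one element. $L^T$ is the set of all functions $T\to L$, ordered pointwise. The tense operators $P,F,H,G\colon L^T\to L^T$ induced by $(T,R)$ are defined, for $q\in L^T$ and $s\in T$, by $P(q)(s):=\bigvee\{q(t)\mid t\mathrel R s\}$, $F(q)(s):=\bigvee\{q(t)\mid s\mathrel R t\}$, $H(q)(s):=\bigwedge\{q(t)\mid t\mathrel R s\}$, $G(q)(s):=\bigwedge\{q(t)\mid s\mathrel R t\}$, where the join of the empty set is $0$ and the meet of the empty set is $1$. Given maps $P,F,H,G\colon L^T\to L^T$, the relation induced by $P$, $F$, $H$ and $G$ is the set of all $(s,t)\in T^2$ such that for all $q\in L^T$: $q(s)\leq P(q)(t)$, $q(t)\leq F(q)(s)$, $H(q)(t)\leq q(s)$ and $G(q)(s)\leq q(t)$. *)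

theory Defs
  imports Main "HOL-Library.FuncSet"
begin

definition time_frame :: "'t set \<Rightarrow> ('t \<times> 't) set \<Rightarrow> bool" where
  "time_frame T R \<longleftrightarrow> T \<noteq> {} \<and> R \<noteq> {} \<and> R \<subseteq> T \<times> T"

text \<open>
  The power \<open>L\<^sup>T\<close> consists of the extensional functions on \<open>T\<close>, so that HOL equality
  is equality of functions \<open>T \<rightarrow> L\<close>. The operators are likewise extensional on \<open>L\<^sup>T\<close>, so
  that HOL equality is equality of maps \<open>L\<^sup>T \<rightarrow> L\<^sup>T\<close>. In a complete lattice,
  \<open>\<Squnion>{} = bot\<close> and \<open>\<Sqinter>{} = top\<close>, as the conventions on empty joins and meets require.
\<close>

definition fpower :: "'t set \<Rightarrow> ('t \<Rightarrow> 'l) set" where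
  "fpower T = (T \<rightarrow>\<^sub>E UNIV)"

definition tense_P ::
    "'t set \<Rightarrow> ('t \<times> 't) set \<Rightarrow> ('t \<Rightarrow> 'l) \<Rightarrow> ('t \<Rightarrow> 'l::complete_lattice)" where
  "tense_P T R = (\<lambda>q\<in>fpower T. \<lambda>s\<in>T. Sup {q t | t. (t, s) \<in> R})"

definition tense_F ::
    "'t set \<Rightarrow> ('t \<times> 't) set \<Rightarrow> ('t \<Rightarrow> 'l) \<Rightarrow> ('t \<Rightarrow> 'l::complete_lattice)" where
  "tense_F T R = (\<lambda>q\<in>fpower T. \<lambda>s\<in>T. Sup {q t | t. (s, t) \<in> R})"

definition tense_H ::
    "'t set \<Rightarrow> ('t \<times> 't) set \<Rightarrow> ('t \<Rightarrow> 'l) \<Rightarrow> ('t \<Rightarrow> 'l::complete_lattice)" where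
  "tense_H T R = (\<lambda>q\<in>fpower T. \<lambda>s\<in>T. Inf {q t | t. (t, s) \<in> R})"

definition tense_G ::
    "'t set \<Rightarrow> ('t \<times> 't) set \<Rightarrow> ('t \<Rightarrow> 'l) \<Rightarrow> ('t \<Rightarrow> 'l::complete_lattice)" where
  "tense_G T R = (\<lambda>q\<in>fpower T. \<lambda>s\<in>T. Inf {q t | t. (s, t) \<in> R})"

definition induced_relation ::
    "'t set \<Rightarrow> (('t \<Rightarrow> 'l) \<Rightarrow> ('t \<Rightarrow> 'l)) \<Rightarrow> (('t \<Rightarrow> 'l) \<Rightarrow> ('t \<Rightarrow> 'l))
      \<Rightarrow> (('t \<Rightarrow> 'l) \<Rightarrow> ('t \<Rightarrow> 'l)) \<Rightarrow> (('t \<Rightarrow> 'l) \<Rightarrow> ('t \<Rightarrow> 'l::complete_lattice))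
      \<Rightarrow> ('t \<times> 't) set" where
  "induced_relation T P F H G =
    {(s, t) \<in> T \<times> T. \<forall>q\<in>fpower T.
       q s \<le> P q t \<and> q t \<le> F q s \<and> H q t \<le> q s \<and> G q s \<le> q t}"

end

theory Submission
  imports Defs
begin

text \<open>If \<open>top\<close> equals \<open>bot\<close>, then
  \<open>x \<le> top = bot \<le> y\<close> for any \<open>x\<close> and \<open>y\<close>, so
  antisymmetry collapses the lattice to one element.\<close>

lemma bot_neq_top_if_nontrivial:
  assumes "\<exists>x y :: 'l::complete_lattice. x \<noteq> y"
  shows "(bot :: 'l) \<noteq> top"
proof
  assume eq: "(bot :: 'l) = top"
  have "x = y" for x y :: 'l
    by (rule order_antisym; rule order_trans[OF top_greatest]; simp only: eq[symmetric] bot_least)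
  with assms show False by blast
qed

text \<open>For \<open>(s, t) \<in> R\<close>, the value \<open>q s\<close> is one of those joined
  in \<open>P q t\<close> and met in \<open>H q t\<close>, and \<open>q t\<close> is one of those
  joined in \<open>F q s\<close> and met in \<open>G q s\<close>.\<close>

lemma subset_induced_relation:
  assumes "R \<subseteq> T \<times> T"
  shows "R \<subseteq> induced_relation T (tense_P T R) (tense_F T R) (tense_H T R)
    (tense_G T R :: ('t \<Rightarrow> 'l) \<Rightarrow> 't \<Rightarrow> 'l::complete_lattice)"
  using assms
  by (auto simp: induced_relation_def tense_P_def tense_F_def tense_H_def tense_G_def
      intro!: Sup_upper Inf_lower)

text \<open>The function that is \<open>top\<close> at \<open>s\<close> and \<open>bot\<close> elsewhere detects through \<open>P\<close> alone
  whether \<open>s\<close> is a predecessor of \<open>t\<close>.\<close>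

lemma induced_relation_tense_P_subset:
  fixes F H G :: "('t \<Rightarrow> 'l) \<Rightarrow> ('t \<Rightarrow> 'l::complete_lattice)"
  assumes "(bot :: 'l) \<noteq> top" and R: "R \<subseteq> T \<times> T"
  shows "induced_relation T (tense_P T R) F H G \<subseteq> R"
proof clarify
  fix s t
  assume st: "(s, t) \<in> induced_relation T (tense_P T R) F H G"
  define q :: "'t \<Rightarrow> 'l" where "q = (\<lambda>u\<in>T. if u = s then top else bot)"
  have mem: "s \<in> T" "t \<in> T" and q: "q \<in> fpower T"
    using st by (auto simp: induced_relation_def fpower_def q_def)
  with st have le: "q s \<le> Sup {q u | u. (u, t) \<in> R}"
    by (auto simp: induced_relation_def tense_P_def)
  show "(s, t) \<in> R"
  proof (rule ccontr)
    assume "(s, t) \<notin> R"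
    \<comment> \<open>Here \<open>u \<noteq> s\<close> because \<open>(s, t)\<close> is not in
      \<open>R\<close>, and \<open>u \<in> T\<close> because \<open>R\<close> is a relation on
      \<open>T\<close>, so \<open>q u\<close> is \<open>bot\<close> and not
      \<open>undefined\<close>.\<close>
    then have "q u = bot" if "(u, t) \<in> R" for u
      using that R by (auto simp: q_def)
    then have "Sup {q u | u. (u, t) \<in> R} \<le> bot"
      by (auto intro!: Sup_least)
    with le have "q s \<le> bot"
      by (rule order_trans)
    \<comment> \<open>Since \<open>s \<in> T\<close>, the value \<open>q s\<close> is
      \<open>top\<close>, so the bound forces \<open>top = bot\<close>.\<close>
    with mem assms(1) show False
      by (simp add: q_def bot_unique)
  qed
qed

theorem theorem5p6:
  fixes T :: "'t set" and R Rstar :: "('t \<times> 't) set"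
    and P F H G :: "('t \<Rightarrow> 'l) \<Rightarrow> ('t \<Rightarrow> 'l::complete_lattice)"
  assumes "\<exists>x y :: 'l. x \<noteq> y"
    and "time_frame T R"
    and "P = tense_P T R" and "F = tense_F T R" and "H = tense_H T R" and "G = tense_G T R"
    and "Rstar = induced_relation T P F H G"
  shows "R = Rstar \<and> time_frame T Rstar
    \<and> tense_P T Rstar = P \<and> tense_F T Rstar = F
    \<and> tense_H T Rstar = H \<and> tense_G T Rstar = G"
proof -
  have R: "R \<subseteq> T \<times> T"
    using assms(2) by (simp add: time_frame_def)
  \<comment> \<open>Nontriviality enters in the inclusion of \<open>Rstar\<close> in
    \<open>R\<close>, through \<open>bot \<noteq> top\<close>.\<close>
  have "R = Rstar"
    using subset_induced_relation[OF R, where 'l = 'l]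
      induced_relation_tense_P_subset[OF bot_neq_top_if_nontrivial[OF assms(1)] R]
    unfolding assms(3-7) by (intro subset_antisym)
  then show ?thesis
    using assms(2-6) by blast
qed

end
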